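(* Let $(\Omega,d,\mu)$ be a probability metric space satisfying the standing assumptions in the context, with isoperimetric profile $I$. Let $r\in(0,1]$, let $G:(0,r)\to(0,\infty)$ be a measurable function, and suppose that for every r.i. space $\bar X$ on $(0,1)$ that is away from $L^\infty$ there is a constant $C(X)$ such that $$\int_0^{r}\left\|\left(f^{\ast}(\cdot)-f^{\ast}(t)\right)\chi_{[0,t)}(\cdot)\right\|_{\bar X}G(t)\,dt\le C(X)\left\||\nabla f|^{\ast}\right\|_{\bar X}\qquad\text{for all } f\in Lip(\Omega).$$ Then there is a constant $C$ such that for all Borel sets $A\subset\Omega$ with $\mu(A)\le r$, $$\mu(A)\int_{\mu(A)}^{r}G(t)\,dt\le C\,P(A;\Omega),$$ and consequently $$\frac{t}{I(t)}\int_t^{r}G(s)\,ds\le C\qquad\text{for all } t\in(0,r).$$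
   Context: Standing assumptions. $(\Omega,d,\mu)$ is a connected metric space with a Borel probability measure $\mu$. For a Borel set $A\subset\Omega$, $P(A;\Omega)=\liminf_{h\to0^+}\frac{\mu(A_h)-\mu(A)}{h}$ with $A_h=\{x\in\Omega:d(x,A)<h\}$. The isoperimetric profile is $I(s)=\inf\{P(A;\Omega):\mu(A)=s\}$, $s\in[0,1]$. It is assumed that $I(0)=0$ and that $I$ is continuous, concave and symmetric about $1/2$. $Lip(\Omega)$ is the set of real-valued Lipschitz functions on $\Omega$, and $|\nabla f(x)|=\limsup_{d(x,y)\to0}\frac{|f(x)-f(y)|}{d(x,y)}$. For measurable $u:\Omega\to\mathbb R$, $u^{\ast}(s)=\inf\{t\in\mathbb R:\mu\{u>t\}\le s\}$, $s\in[0,1)$ (it may take negative values; the rearrangement of the absolute value is written $|u|^\ast$). $|\nabla f|^\ast$ is the rearrangement of the function $|\nabla f|$ with respect to $\mu$. A rearrangement invariant (r.i.) space $\bar X$ on $(0,1)$ is a Banach function space over $(0,1)$ with Lebesgue measure, with the Fatou property, such that if $g\in\bar X$ and $|f|^\ast=|g|^\ast$ then $f\in\bar X$ and $\|f\|_{\bar X}=\|g\|_{\bar X}$. "$\bar X$ is away from $L^\infty$" means that the operator $Qg(t)=\int_t^1 g(s)\frac{ds}{s}$ is bounded on $\bar X$ (for instance $\bar X=L^1$). *)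

theory Defs
  imports "HOL-Probability.Probability"
begin

(* The test for emptiness is needed because infdist x {} = 0, whereas d(x, {}) = \<infinity>. *)
definition enlargement :: "'a::metric_space set \<Rightarrow> real \<Rightarrow> 'a set" where
  "enlargement A h = {x. A \<noteq> {} \<and> infdist x A < h}"

(* The difference quotient is nonnegative for h > 0, so ennreal does not truncate. *)
definition perimeter :: "'a::metric_space measure \<Rightarrow> 'a set \<Rightarrow> ennreal" where
  "perimeter \<mu> A =
     Liminf (at_right 0) (\<lambda>h. ennreal ((measure \<mu> (enlargement A h) - measure \<mu> A) / h))"

definition isoperimetric_profile :: "'a::metric_space measure \<Rightarrow> real \<Rightarrow> ennreal" where
  "isoperimetric_profile \<mu> s = (INF A \<in> {A \<in> sets borel. measure \<mu> A = s}. perimeter \<mu> A)"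

(* For Lipschitz f the upper limit is finite and real_of_ereal loses nothing. *)
definition grad_modulus :: "('a::metric_space \<Rightarrow> real) \<Rightarrow> 'a \<Rightarrow> real" where
  "grad_modulus f x = real_of_ereal (Limsup (at x) (\<lambda>y. ereal (\<bar>f x - f y\<bar> / dist x y)))"

(* For a probability measure and 0 < s < 1 the set below is nonempty and bounded below, so the
   real infimum is the intended one.  For s = 0 it may be empty (u essentially unbounded above);
   everything below depends only on the values at 0 < s < 1. *)
definition rearrangement :: "'b measure \<Rightarrow> ('b \<Rightarrow> real) \<Rightarrow> real \<Rightarrow> real" where
  "rearrangement M u s = Inf {t. measure M {x \<in> space M. u x > t} \<le> s}"

abbreviation unit_measure :: "real measure" where
  "unit_measure \<equiv> lebesgue_on {0<..<1}"

(* Function norms in the sense of Bennett and Sharpley, on the cone of measurable functions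
   (0,1) \<rightarrow> [0,\<infinity>].  The fourth clause is the Fatou property; together with the others it
   implies completeness of the space of functions of finite norm. *)
definition function_norm :: "((real \<Rightarrow> ennreal) \<Rightarrow> ennreal) \<Rightarrow> bool" where
  "function_norm \<rho> \<longleftrightarrow>
     (\<forall>f \<in> borel_measurable unit_measure.
        (\<rho> f = 0 \<longleftrightarrow> (AE x in unit_measure. f x = 0)) \<and>
        (\<forall>a\<ge>0. \<rho> (\<lambda>x. ennreal a * f x) = ennreal a * \<rho> f)) \<and>
     (\<forall>f \<in> borel_measurable unit_measure. \<forall>g \<in> borel_measurable unit_measure.
        \<rho> (\<lambda>x. f x + g x) \<le> \<rho> f + \<rho> g) \<and>
     (\<forall>f \<in> borel_measurable unit_measure. \<forall>g \<in> borel_measurable unit_measure.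
        (AE x in unit_measure. f x \<le> g x) \<longrightarrow> \<rho> f \<le> \<rho> g) \<and>
     (\<forall>F. \<forall>f \<in> borel_measurable unit_measure.
        (\<forall>n::nat. F n \<in> borel_measurable unit_measure) \<and>
        (AE x in unit_measure. incseq (\<lambda>n. F n x) \<and> (SUP n. F n x) = f x)
        \<longrightarrow> (SUP n. \<rho> (F n)) = \<rho> f) \<and>
     (\<forall>E \<in> sets unit_measure. \<rho> (indicator E) < \<infinity>) \<and>
     (\<forall>E \<in> sets unit_measure. \<exists>C>0. \<forall>f \<in> borel_measurable unit_measure.
        (\<integral>\<^sup>+x\<in>E. f x \<partial>unit_measure) \<le> ennreal C * \<rho> f)"

definition bfs_norm :: "((real \<Rightarrow> ennreal) \<Rightarrow> ennreal) \<Rightarrow> (real \<Rightarrow> real) \<Rightarrow> ennreal" where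
  "bfs_norm \<rho> f = \<rho> (\<lambda>x. ennreal \<bar>f x\<bar>)"

definition bfs_carrier :: "((real \<Rightarrow> ennreal) \<Rightarrow> ennreal) \<Rightarrow> (real \<Rightarrow> real) set" where
  "bfs_carrier \<rho> = {f \<in> borel_measurable unit_measure. bfs_norm \<rho> f < \<infinity>}"

(* Rearrangements are right-continuous, so agreement on (0,1) is agreement on [0,1). *)
definition ri_space :: "((real \<Rightarrow> ennreal) \<Rightarrow> ennreal) \<Rightarrow> bool" where
  "ri_space \<rho> \<longleftrightarrow> function_norm \<rho> \<and>
     (\<forall>g \<in> bfs_carrier \<rho>. \<forall>f \<in> borel_measurable unit_measure.
        (\<forall>s\<in>{0<..<1}. rearrangement unit_measure (\<lambda>x. \<bar>f x\<bar>) s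
                       = rearrangement unit_measure (\<lambda>x. \<bar>g x\<bar>) s)
        \<longrightarrow> f \<in> bfs_carrier \<rho> \<and> bfs_norm \<rho> f = bfs_norm \<rho> g)"

definition Q_op :: "(real \<Rightarrow> real) \<Rightarrow> real \<Rightarrow> real" where
  "Q_op g t = (LINT s:{t<..<1}|lebesgue. g s / s)"

definition away_from_Linfty :: "((real \<Rightarrow> ennreal) \<Rightarrow> ennreal) \<Rightarrow> bool" where
  "away_from_Linfty \<rho> \<longleftrightarrow>
     (\<exists>K\<ge>0. \<forall>g \<in> bfs_carrier \<rho>.
        Q_op g \<in> bfs_carrier \<rho> \<and> bfs_norm \<rho> (Q_op g) \<le> ennreal K * bfs_norm \<rho> g)"

end

theory Submission
  imports Defs
begin

text \<open>
  Only the space $L^1$ is needed. For a Borel set $A$ of measure $m$ and $h > 0$ take for $f$ the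
  function of $d(\cdot,A)$ that is $1$ up to distance $h/4$, $0$ from distance $3h/4$ on and linear
  in between. Its gradient is at most $2/h$ and lives on $A_h \setminus A$, so its $L^1$ norm is at
  most $2(\mu(A_h)-\mu(A))/h$. On the other hand $f^*(s) - f^*(t) \ge 1$ for $s < m$ and
  $t \ge \mu(A_h)$, so the left-hand side is at least $m\int_{\mu(A_h)}^r G$. Let $h \to 0$.
  Keeping the slope away from $A$ and from the boundary of $A_h$ makes $f$ locally constant outside
  $A_h \setminus A$, so no regularity of $A$ is required.
\<close>

section \<open>The space L^1 on the unit interval as a function norm\<close>

definition L1_norm :: "(real \<Rightarrow> ennreal) \<Rightarrow> ennreal" where
  "L1_norm f = (\<integral>\<^sup>+x. f x \<partial>unit_measure)"

lemma emeasure_unit_measure_initial: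
  assumes "0 \<le> m" "m \<le> 1"
  shows "emeasure unit_measure {0<..<m} = ennreal m"
  using assms by (subst emeasure_restrict_space) auto

lemma prob_space_unit_measure: "prob_space unit_measure"
  by (rule prob_spaceI) (use emeasure_unit_measure_initial[of 1] in simp)

lemma function_norm_L1: "function_norm L1_norm"
  unfolding function_norm_def L1_norm_def
proof (intro conjI allI ballI impI)
  fix f :: "real \<Rightarrow> ennreal" assume "f \<in> borel_measurable unit_measure"
  then show "((\<integral>\<^sup>+x. f x \<partial>unit_measure) = 0) = (AE x in unit_measure. f x = 0)"
    by (rule nn_integral_0_iff_AE)
next
  fix F :: "nat \<Rightarrow> real \<Rightarrow> ennreal" and f
  assume *: "(\<forall>n. F n \<in> borel_measurable unit_measure) \<and>
        (AE x in unit_measure. incseq (\<lambda>n. F n x) \<and> (SUP n. F n x) = f x)"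
  have "(\<integral>\<^sup>+x. (SUP n. F n x) \<partial>unit_measure) = (SUP n. \<integral>\<^sup>+x. F n x \<partial>unit_measure)"
  proof (rule nn_integral_monotone_convergence_SUP_AE)
    fix i show "AE x in unit_measure. F i x \<le> F (Suc i) x"
      using * by (auto simp: incseq_Suc_iff elim: AE_mp)
  qed (use * in auto)
  moreover have "(\<integral>\<^sup>+x. (SUP n. F n x) \<partial>unit_measure) = (\<integral>\<^sup>+x. f x \<partial>unit_measure)"
    by (rule nn_integral_cong_AE) (use * in auto)
  ultimately show "(SUP n. \<integral>\<^sup>+x. F n x \<partial>unit_measure) = (\<integral>\<^sup>+x. f x \<partial>unit_measure)"
    by simp
next
  interpret prob_space unit_measure by (rule prob_space_unit_measure)
  fix E assume "E \<in> sets unit_measure"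
  then show "(\<integral>\<^sup>+x. indicator E x \<partial>unit_measure) < \<infinity>"
    by (simp add: less_top[symmetric])
  show "\<exists>C>0. \<forall>f\<in>borel_measurable unit_measure.
          (\<integral>\<^sup>+x\<in>E. f x \<partial>unit_measure) \<le> ennreal C * (\<integral>\<^sup>+x. f x \<partial>unit_measure)"
    by (rule exI[of _ 1]) (auto intro!: nn_integral_mono simp: indicator_def)
qed (auto intro: nn_integral_cmult nn_integral_mono_AE simp: nn_integral_add)

section \<open>Rearrangements, distribution functions and rearrangement invariance\<close>

lemma (in prob_space) measure_greater_eq_cdf:
  assumes "u \<in> borel_measurable M"
  shows "prob {x \<in> space M. u x > t} = 1 - cdf (distr M borel u) t"
proof -
  have "cdf (distr M borel u) t = prob {x \<in> space M. u x \<le> t}"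
    using assms by (simp add: cdf_def measure_distr vimage_def Int_def conj_commute)
  moreover have "prob (space M - {x \<in> space M. u x \<le> t}) = 1 - prob {x \<in> space M. u x \<le> t}"
    using assms by (intro prob_compl) measurable
  moreover have "space M - {x \<in> space M. u x \<le> t} = {x \<in> space M. u x > t}"
    by auto
  ultimately show ?thesis by simp
qed

text \<open>The rearrangement is a quantile function: it is the infimum of the levels where the cdf
  reaches \<open>1 - s\<close>, and right-continuity of the cdf makes this infimum attained.\<close>

lemma (in prob_space) rearrangement_le_iff:
  assumes u: "u \<in> borel_measurable M" and s: "0 < s" "s < 1"
  shows "rearrangement M u s \<le> t \<longleftrightarrow> prob {x \<in> space M. u x > t} \<le> s"
proof -
  interpret D: real_distribution "distr M borel u"
    using u by (rule real_distribution_distr)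
  let ?F = "cdf (distr M borel u)"
  have R: "rearrangement M u s = Inf {t. 1 - s \<le> ?F t}"
    unfolding rearrangement_def measure_greater_eq_cdf[OF u] by (simp add: algebra_simps)
  \<comment> \<open>The limit 0 of the cdf at minus infinity and \<open>s < 1\<close> bound the set
    of levels from below; the limit 1 at plus infinity and \<open>0 < s\<close> make it nonempty.
    Without both, the real \<open>Inf\<close> would carry no information.\<close>
  have "eventually (\<lambda>t. ?F t < 1 - s) at_bot"
    using D.cdf_lim_at_bot s by (intro order_tendstoD) auto
  then obtain b where b: "\<And>t. t \<le> b \<Longrightarrow> ?F t < 1 - s"
    by (auto simp: eventually_at_bot_linorder)
  have bdd: "bdd_below {t. 1 - s \<le> ?F t}"
    by (rule bdd_belowI[of _ b]) (use b in \<open>force simp: not_less[symmetric]\<close>)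
  have "eventually (\<lambda>t. ?F t > 1 - s) at_top"
    using D.cdf_lim_at_top_prob s by (intro order_tendstoD) auto
  then obtain c where c: "?F c > 1 - s"
    by (auto simp: eventually_at_top_linorder)
  have "1 - s \<le> ?F t" if le: "Inf {t. 1 - s \<le> ?F t} \<le> t"
  proof (rule ccontr)
    assume "\<not> 1 - s \<le> ?F t"
    moreover have "(?F \<longlongrightarrow> ?F t) (at_right t)"
      using D.cdf_is_right_cont[of t] by (simp add: continuous_within)
    ultimately have "eventually (\<lambda>y. ?F y < 1 - s) (at_right t)"
      by (intro order_tendstoD) auto
    then obtain y where y: "y > t" "\<And>z. t < z \<Longrightarrow> z < y \<Longrightarrow> ?F z < 1 - s"
      unfolding eventually_at_right_field by blast
    obtain z where z: "1 - s \<le> ?F z" "z < y"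
      using cInf_lessD[of "{t. 1 - s \<le> ?F t}" y] less_imp_le[OF c] le_less_trans[OF le y(1)] by blast
    \<comment> \<open>The level \<open>z\<close> may lie at or below \<open>t\<close>. Taking the
      maximum with the midpoint moves it into the interval from \<open>t\<close> to
      \<open>y\<close>, where the cdf is below \<open>1 - s\<close>.\<close>
    have "?F z \<le> ?F (max z ((t + y) / 2))"
      by (rule D.cdf_nondecreasing) simp
    moreover have "t < max z ((t + y) / 2)" "max z ((t + y) / 2) < y"
      using y(1) z(2) by (auto simp: less_max_iff_disj)
    then have "?F (max z ((t + y) / 2)) < 1 - s"
      by (rule y(2))
    ultimately show False using z by simp
  qed
  moreover have "Inf {t. 1 - s \<le> ?F t} \<le> t" if "1 - s \<le> ?F t"
    using that bdd by (intro cInf_lower) auto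
  ultimately show ?thesis
    unfolding R measure_greater_eq_cdf[OF u] by (auto simp: algebra_simps)
qed

text \<open>If the distribution functions differed at some \<open>t\<close>, a level
  \<open>s\<close> strictly between their values there would put one rearrangement at
  \<open>s\<close> above \<open>t\<close> and the other at most \<open>t\<close>.\<close>

lemma (in prob_space) distr_eq_of_rearrangement_eq:
  assumes u: "u \<in> borel_measurable M" and v: "v \<in> borel_measurable M"
    and eq: "\<And>s. 0 < s \<Longrightarrow> s < 1 \<Longrightarrow> rearrangement M u s = rearrangement M v s"
  shows "distr M borel u = distr M borel v"
proof (rule cdf_unique)
  show "cdf (distr M borel u) = cdf (distr M borel v)"
  proof
    fix t
    have le: "prob {x \<in> space M. u x > t} \<le> prob {x \<in> space M. v x > t}"
      if u: "u \<in> borel_measurable M" and v: "v \<in> borel_measurable M"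
        and eq: "\<And>s. 0 < s \<Longrightarrow> s < 1 \<Longrightarrow> rearrangement M u s = rearrangement M v s" for u v
    proof (rule ccontr)
      assume "\<not> ?thesis"
      then obtain s where s: "prob {x \<in> space M. v x > t} < s" "s < prob {x \<in> space M. u x > t}"
        using dense by (auto simp: not_le)
      then have "0 < s" "s < 1"
        by (auto intro: le_less_trans[OF measure_nonneg] less_le_trans[OF _ prob_le_1])
      with s show False
        using rearrangement_le_iff[OF u, of s t] rearrangement_le_iff[OF v, of s t] eq[of s] by simp
    qed
    show "cdf (distr M borel u) t = cdf (distr M borel v) t"
      using le[OF u v eq] le[OF v u eq[symmetric]]
      unfolding measure_greater_eq_cdf[OF u] measure_greater_eq_cdf[OF v] by simp
  qed
qed (use u v in \<open>auto intro: real_distribution_distr\<close>)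

text \<open>The norm is the integral of the identity against the law of
  \<open>\<bar>f\<bar>\<close>, and the rearrangement determines this law.\<close>

lemma ri_space_L1: "ri_space L1_norm"
  unfolding ri_space_def
proof (intro conjI ballI impI)
  interpret prob_space unit_measure by (rule prob_space_unit_measure)
  fix g f assume g: "g \<in> bfs_carrier L1_norm" and f: "f \<in> borel_measurable unit_measure"
    and eq: "\<forall>s\<in>{0<..<1}. rearrangement unit_measure (\<lambda>x. \<bar>f x\<bar>) s
                       = rearrangement unit_measure (\<lambda>x. \<bar>g x\<bar>) s"
  have gm: "g \<in> borel_measurable unit_measure"
    using g by (simp add: bfs_carrier_def)
  have "distr unit_measure borel (\<lambda>x. \<bar>f x\<bar>) = distr unit_measure borel (\<lambda>x. \<bar>g x\<bar>)"
    by (rule distr_eq_of_rearrangement_eq) (use f gm eq in auto)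
  then have "(\<integral>\<^sup>+y. ennreal y \<partial>distr unit_measure borel (\<lambda>x. \<bar>f x\<bar>)) =
      (\<integral>\<^sup>+y. ennreal y \<partial>distr unit_measure borel (\<lambda>x. \<bar>g x\<bar>))"
    by simp
  then show norm_eq: "bfs_norm L1_norm f = bfs_norm L1_norm g"
    using f gm by (simp add: nn_integral_distr bfs_norm_def L1_norm_def)
  show "f \<in> bfs_carrier L1_norm"
    using f g norm_eq by (simp add: bfs_carrier_def)
qed (rule function_norm_L1)

section \<open>Boundedness of Q on L^1\<close>

text \<open>Tonelli: after exchanging the integrals, the inner integration over t < s contributes a
  factor s that cancels the kernel 1/s. Hence the operator bound is 1.\<close>

lemma away_from_Linfty_L1: "away_from_Linfty L1_norm"
  unfolding away_from_Linfty_def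
proof (intro exI[of _ 1] conjI ballI)
  fix g assume g: "g \<in> bfs_carrier L1_norm"
  have gm: "g \<in> borel_measurable unit_measure"
    using g by (simp add: bfs_carrier_def)
  define k where "k s = indicator {0<..<1} s *\<^sub>R g s / s" for s
  have "(\<lambda>s. indicator {0<..<1} s *\<^sub>R g s) \<in> borel_measurable lebesgue"
    using gm by (subst (asm) borel_measurable_restrict_space_iff) auto
  then have "k \<in> borel_measurable lebesgue"
    unfolding k_def by (intro borel_measurable_divide) (auto intro: measurable_completion)
  \<comment> \<open>The extension by zero \<open>k\<close> is only Lebesgue measurable; exchanging
    integrals over the product of \<open>lborel\<close> with itself calls for a Borel
    version.\<close>
  then obtain k' where k'[measurable]: "k' \<in> borel_measurable lborel"
    and kk': "AE s in lborel. k s = k' s"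
    using completion_ex_borel_measurable_real by blast
  have kk'L: "AE s in lebesgue. k s = k' s"
    using kk' by (rule AE_completion)
  have Q: "Q_op g t = (LINT s|lborel. indicator {t<..<1} s * k' s)" if "0 < t" for t
  proof -
    have "Q_op g t = (LINT s|lebesgue. indicator {t<..<1} s * k' s)"
      unfolding Q_op_def set_lebesgue_integral_def
    proof (rule integral_cong_AE)
      show "AE s in lebesgue. indicator {t<..<1} s *\<^sub>R (g s / s) = indicator {t<..<1} s * k' s"
        using kk'L by eventually_elim (use that in \<open>auto simp: k_def indicator_def split: if_splits\<close>)
      have "(\<lambda>s. indicator {t<..<1} s * k s) \<in> borel_measurable lebesgue"
        by (rule borel_measurable_times[OF measurable_completion \<open>k \<in> borel_measurable lebesgue\<close>]) measurable
      also have "(\<lambda>s. indicator {t<..<1} s * k s) = (\<lambda>s. indicator {t<..<1} s *\<^sub>R (g s / s))"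
        using that by (auto simp: k_def indicator_def fun_eq_iff)
      finally show "\<dots> \<in> borel_measurable lebesgue" .
    next
      show "(\<lambda>s. indicator {t<..<1} s * k' s) \<in> borel_measurable lebesgue"
        by (rule measurable_completion) measurable
    qed
    also have "\<dots> = (LINT s|lborel. indicator {t<..<1} s * k' s)"
      by (rule integral_completion) measurable
    finally show ?thesis .
  qed
  \<comment> \<open>Unfolding the interval and its indicator exposes the condition jointly in
    \<open>t\<close> and \<open>s\<close>, from which measurability in the parameter
    \<open>t\<close> follows.\<close>
  have m1: "(\<lambda>t. LINT s|lborel. indicator {t<..<1} s * k' s) \<in> borel_measurable borel"
    unfolding greaterThanLessThan_def greaterThan_def lessThan_def indicator_def by measurable
  then have "(\<lambda>t. LINT s|lborel. indicator {t<..<1} s * k' s) \<in> borel_measurable unit_measure"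
    by (intro measurable_restrict_space1 measurable_completion) simp
  then have Qm: "Q_op g \<in> borel_measurable unit_measure"
    by (rule measurable_cong[THEN iffD1, rotated]) (simp add: Q)
  have "bfs_norm L1_norm (Q_op g) = (\<integral>\<^sup>+t. ennreal \<bar>Q_op g t\<bar> * indicator {0<..<1} t \<partial>lebesgue)"
    unfolding bfs_norm_def L1_norm_def by (subst nn_integral_restrict_space) auto
  also have "\<dots> \<le> (\<integral>\<^sup>+t. (\<integral>\<^sup>+s. indicator {t<..<1} s * ennreal \<bar>k' s\<bar> \<partial>lborel) * indicator {0<..<1} t \<partial>lebesgue)"
  proof (rule nn_integral_mono)
    fix t :: real
    have "ennreal \<bar>Q_op g t\<bar> \<le> (\<integral>\<^sup>+s. indicator {t<..<1} s * ennreal \<bar>k' s\<bar> \<partial>lborel)"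
      if t: "0 < t"
    proof (cases "integrable lborel (\<lambda>s. indicator {t<..<1} s * k' s)")
      case True
      have "ennreal \<bar>Q_op g t\<bar> \<le> (\<integral>\<^sup>+s. norm (indicator {t<..<1} s * k' s) \<partial>lborel)"
        unfolding Q[OF t] real_norm_def[symmetric] by (rule integral_norm_bound_ennreal[OF True])
      also have "\<dots> = (\<integral>\<^sup>+s. indicator {t<..<1} s * ennreal \<bar>k' s\<bar> \<partial>lborel)"
        by (rule nn_integral_cong) (auto simp: indicator_def)
      finally show ?thesis .
    next
      \<comment> \<open>The Bochner integral is 0 by default here, so the bound is trivial.\<close>
      case False
      then show ?thesis unfolding Q[OF t] by (simp add: not_integrable_integral_eq)
    qed
    then show "ennreal \<bar>Q_op g t\<bar> * indicator {0<..<1} t \<le>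
       (\<integral>\<^sup>+s. indicator {t<..<1} s * ennreal \<bar>k' s\<bar> \<partial>lborel) * indicator {0<..<1} t"
      by (auto simp: indicator_def)
  qed
  also have "\<dots> = (\<integral>\<^sup>+t. (\<integral>\<^sup>+s. indicator {t<..<1} s * ennreal \<bar>k' s\<bar> \<partial>lborel) * indicator {0<..<1} t \<partial>lborel)"
    unfolding greaterThanLessThan_def greaterThan_def lessThan_def indicator_def
    by (rule nn_integral_completion)
  also have "\<dots> = (\<integral>\<^sup>+t. (\<integral>\<^sup>+s. indicator {t<..<1} s * ennreal \<bar>k' s\<bar> * indicator {0<..<1} t \<partial>lborel) \<partial>lborel)"
    by (intro nn_integral_cong nn_integral_multc[symmetric]) measurable
  also have "\<dots> = (\<integral>\<^sup>+s. (\<integral>\<^sup>+t. indicator {t<..<1} s * ennreal \<bar>k' s\<bar> * indicator {0<..<1} t \<partial>lborel) \<partial>lborel)"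
    unfolding greaterThanLessThan_def greaterThan_def lessThan_def indicator_def
    by (rule lborel_pair.Fubini') measurable
  also have "\<dots> = (\<integral>\<^sup>+s. ennreal \<bar>k' s\<bar> * ennreal s * indicator {0<..<1} s \<partial>lborel)"
  proof (rule nn_integral_cong)
    \<comment> \<open>For fixed \<open>s\<close> below 1 the admissible \<open>t\<close> fill the
      interval from 0 to \<open>s\<close>, whose length is the cancelling factor.\<close>
    fix s :: real
    have "(\<integral>\<^sup>+t. indicator {t<..<1} s * ennreal \<bar>k' s\<bar> * indicator {0<..<1} t \<partial>lborel) =
        (\<integral>\<^sup>+t. (ennreal \<bar>k' s\<bar> * indicator {..<1} s) * indicator {0<..<s} t \<partial>lborel)"
      by (rule nn_integral_cong) (auto simp: indicator_def)
    also have "\<dots> = (ennreal \<bar>k' s\<bar> * indicator {..<1} s) * emeasure lborel {0<..<s}"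
      by (rule nn_integral_cmult_indicator) simp
    also have "\<dots> = ennreal \<bar>k' s\<bar> * ennreal s * indicator {0<..<1} s"
      by (cases "0 < s") (auto simp: indicator_def)
    finally show "(\<integral>\<^sup>+t. indicator {t<..<1} s * ennreal \<bar>k' s\<bar> * indicator {0<..<1} t \<partial>lborel) =
      ennreal \<bar>k' s\<bar> * ennreal s * indicator {0<..<1} s" .
  qed
  also have "\<dots> = (\<integral>\<^sup>+s. ennreal \<bar>k' s\<bar> * ennreal s * indicator {0<..<1} s \<partial>lebesgue)"
    by (rule nn_integral_completion[symmetric])
  also have "\<dots> = (\<integral>\<^sup>+s. ennreal \<bar>g s\<bar> * indicator {0<..<1} s \<partial>lebesgue)"
  proof (rule nn_integral_cong_AE)
    show "AE s in lebesgue. ennreal \<bar>k' s\<bar> * ennreal s * indicator {0<..<1} s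
        = ennreal \<bar>g s\<bar> * indicator {0<..<1} s"
      using kk'L
    proof eventually_elim
      case (elim s)
      then show ?case
        by (cases "s \<in> {0<..<1}") (auto simp: k_def ennreal_mult[symmetric] elim[symmetric])
    qed
  qed
  also have "\<dots> = bfs_norm L1_norm g"
    unfolding bfs_norm_def L1_norm_def by (subst nn_integral_restrict_space) auto
  finally show le: "bfs_norm L1_norm (Q_op g) \<le> ennreal 1 * bfs_norm L1_norm g"
    by simp
  show "Q_op g \<in> bfs_carrier L1_norm"
    using Qm le g by (auto simp: bfs_carrier_def intro: le_less_trans)
qed simp

section \<open>Gradient modulus, enlargements and the cutoff function\<close>

lemma grad_modulus_bounds:
  assumes "0 \<le> L" and ev: "eventually (\<lambda>y. \<bar>f x - f y\<bar> \<le> L * dist x y) (at x)"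
  shows "0 \<le> grad_modulus f x" "grad_modulus f x \<le> L"
proof -
  let ?q = "\<lambda>y. ereal (\<bar>f x - f y\<bar> / dist x y)"
  have ub: "Limsup (at x) ?q \<le> ereal L"
  proof (rule Limsup_bounded)
    have "eventually (\<lambda>y. y \<noteq> x) (at x)"
      by (simp add: eventually_at_filter)
    with ev show "eventually (\<lambda>y. ?q y \<le> ereal L) (at x)"
      by eventually_elim (auto simp: divide_simps)
  qed
  show "0 \<le> grad_modulus f x"
  \<comment> \<open>At an isolated point the upper limit is minus infinity, which
    \<open>real_of_ereal\<close> sends to 0.\<close>
  proof (cases "at x = bot")
    case False
    have "ereal 0 \<le> Limsup (at x) ?q"
      by (rule le_Limsup[OF False]) (simp add: always_eventually)
    then show ?thesis
      by (simp add: grad_modulus_def real_of_ereal_pos zero_ereal_def)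
  qed (simp add: grad_modulus_def bot_ereal_def)
  show "grad_modulus f x \<le> L"
    using ub \<open>0 \<le> L\<close> unfolding grad_modulus_def by (cases "Limsup (at x) ?q") auto
qed

lemma open_enlargement: "open (enlargement A h)"
  unfolding enlargement_def by (cases "A = {}") (auto intro!: open_Collect_less continuous_intros)

lemma enlargement_mono: "h \<le> k \<Longrightarrow> enlargement A h \<subseteq> enlargement A k"
  by (auto simp: enlargement_def)

lemma subset_enlargement: "0 < h \<Longrightarrow> A \<subseteq> enlargement A h"
  by (auto simp: enlargement_def)

text \<open>The constants make the affine part equal to 1 at distance h/4 and 0 at distance 3h/4.
  For empty \<open>A\<close> the convention \<open>infdist x {} = 0\<close> gives the constant 1, so
  the empty set is treated apart below.\<close>

definition cutoff :: "'a::metric_space set \<Rightarrow> real \<Rightarrow> 'a \<Rightarrow> real" where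
  "cutoff A h x = max 0 (min 1 (3 / 2 - 2 / h * infdist x A))"

lemma cutoff_bounds: "0 \<le> cutoff A h x" "cutoff A h x \<le> 1"
  by (auto simp: cutoff_def)

lemma cutoff_diff_le:
  assumes "0 < h"
  shows "\<bar>cutoff A h x - cutoff A h y\<bar> \<le> 2 / h * dist x y"
proof -
  have "\<bar>2 / h * infdist x A - 2 / h * infdist y A\<bar> = 2 / h * \<bar>infdist x A - infdist y A\<bar>"
    using assms by (simp only: abs_mult right_diff_distrib[symmetric]) simp
  also have "\<dots> \<le> 2 / h * dist x y"
    using assms by (intro mult_left_mono infdist_triangle_abs) auto
  finally show ?thesis unfolding cutoff_def by linarith
qed

lemma lipschitz_cutoff:
  assumes "0 < h"
  shows "(2 / h)-lipschitz_on UNIV (cutoff A h)"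
  using assms cutoff_diff_le[OF assms] by (intro lipschitz_onI) (auto simp: dist_real_def)

lemma cutoff_eq_1:
  assumes "0 < h" "infdist x A < h / 4"
  shows "cutoff A h x = 1"
proof -
  have "2 / h * infdist x A \<le> 1 / 2" using assms by (simp add: field_simps)
  then show ?thesis by (auto simp: cutoff_def)
qed

lemma cutoff_eq_0:
  assumes "0 < h" "infdist x A > 3 * h / 4"
  shows "cutoff A h x = 0"
proof -
  have "2 / h * infdist x A \<ge> 3 / 2" using assms by (simp add: field_simps)
  then show ?thesis by (auto simp: cutoff_def)
qed

text \<open>The distance is 0 on \<open>A\<close> and at least \<open>h\<close> off the enlargement.
  The strict inequalities with h/4 and 3h/4 persist near the point by continuity, so the Lipschitz
  bound holds there with constant 0.\<close>

lemma grad_cutoff_eq_0: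
  assumes h: "0 < h" and "A \<noteq> {}" and x: "x \<notin> enlargement A h - A"
  shows "grad_modulus (cutoff A h) x = 0"
proof -
  have c: "((\<lambda>y. infdist y A) \<longlongrightarrow> infdist x A) (at x)"
    by (intro tendsto_intros)
  have "eventually (\<lambda>y. cutoff A h y = cutoff A h x) (at x)"
  proof (cases "x \<in> A")
    case True
    then have "infdist x A < h / 4" using h by simp
    from order_tendstoD(2)[OF c this] this show ?thesis
      by (auto simp: cutoff_eq_1[OF h] elim!: eventually_mono)
  next
    case False
    then have "infdist x A > 3 * h / 4" using h x \<open>A \<noteq> {}\<close> by (auto simp: enlargement_def)
    from order_tendstoD(1)[OF c this] this show ?thesis
      by (auto simp: cutoff_eq_0[OF h] elim!: eventually_mono)
  qed
  then have "eventually (\<lambda>y. \<bar>cutoff A h x - cutoff A h y\<bar> \<le> 0 * dist x y) (at x)"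
    by eventually_elim simp
  from grad_modulus_bounds[OF _ this] show ?thesis by simp
qed

section \<open>L^1 estimates for the two sides of the hypothesis\<close>

text \<open>The function \<open>w\<close> need not be measurable: \<open>measure\<close> is \<open>0\<close> on nonmeasurable sets, which
  preserves the upper bounds on its distribution function.\<close>

lemma (in prob_space) L1_norm_rearrangement_le:
  assumes S: "S \<in> sets M" and w0: "\<And>x. 0 \<le> w x" and wL: "\<And>x. w x \<le> L" and "0 \<le> L"
    and wS: "\<And>x. x \<notin> S \<Longrightarrow> w x = 0"
  shows "bfs_norm L1_norm (rearrangement M w) \<le> ennreal (L * prob S)"
proof -
  have bound: "ennreal \<bar>rearrangement M w s\<bar> \<le> ennreal L * indicator {0<..<prob S} s"
    if s: "0 < s" "s < 1" for s
  proof -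
    let ?T = "{t. prob {x \<in> space M. w x > t} \<le> s}"
    \<comment> \<open>At a negative level the superlevel set is the whole space, of measure 1 >
      \<open>s\<close>. This supplies both the lower bound for \<open>Inf\<close> and
      nonnegativity.\<close>
    have lb: "0 \<le> t" if "t \<in> ?T" for t
    proof (rule ccontr)
      assume "\<not> 0 \<le> t"
      then have "w x > t" for x using w0[of x] by linarith
      then have "{x \<in> space M. w x > t} = space M" by auto
      with that s show False by (simp add: prob_space)
    qed
    then have bdd: "bdd_below ?T" by (rule bdd_belowI)
    have "{x \<in> space M. w x > L} = {}" using wL by (auto simp: not_less)
    then have "prob {x \<in> space M. w x > L} = 0" by (simp only: measure_empty)
    then have L: "L \<in> ?T" using s by simp
    have 1: "0 \<le> rearrangement M w s"
      unfolding rearrangement_def using L lb by (intro cInf_greatest) auto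
    have 2: "rearrangement M w s \<le> L"
      unfolding rearrangement_def using L bdd by (rule cInf_lower)
    have 3: "rearrangement M w s \<le> 0" if "prob S \<le> s"
    proof -
      have "{x \<in> space M. w x > 0} \<subseteq> S" using wS by force
      then have "prob {x \<in> space M. w x > 0} \<le> prob S"
        using S by (rule finite_measure_mono)
      with that have "0 \<in> ?T" by simp
      then show ?thesis unfolding rearrangement_def using bdd by (rule cInf_lower)
    qed
    show ?thesis
      using 1 2 3 s by (cases "s < prob S") (auto simp: ennreal_leI)
  qed
  have "bfs_norm L1_norm (rearrangement M w) \<le>
      (\<integral>\<^sup>+s. ennreal L * indicator {0<..<prob S} s \<partial>unit_measure)"
    unfolding bfs_norm_def L1_norm_def
    by (rule nn_integral_mono) (auto intro!: bound)
  also have "\<dots> = ennreal L * emeasure unit_measure {0<..<prob S}"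
    by (rule nn_integral_cmult_indicator)
      (auto simp: sets_restrict_space_iff intro: less_le_trans[OF _ prob_le_1])
  also have "\<dots> = ennreal (L * prob S)"
    using \<open>0 \<le> L\<close> by (simp add: emeasure_unit_measure_initial ennreal_mult)
  finally show ?thesis .
qed

text \<open>The cutoff is 1 on \<open>A\<close>, so its rearrangement is at least 1 at every
  positive level below the measure of \<open>A\<close>; it vanishes off the enlargement, so at
  \<open>t\<close> the rearrangement is at most 0.\<close>

lemma L1_norm_rearrangement_cutoff_ge:
  fixes M :: "'a::metric_space measure"
  assumes M: "prob_space M" and sets: "sets M = sets borel" and h: "0 < h"
    and t: "measure M (enlargement A h) \<le> t" "t < 1"
  shows "ennreal (measure M A) \<le> bfs_norm L1_norm
    (\<lambda>s. (rearrangement M (cutoff A h) s - rearrangement M (cutoff A h) t) * indicator {0..<t} s)"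
proof (cases "A = {}")
  case False
  interpret prob_space M by (rule M)
  let ?f = "cutoff A h"
  have space: "space M = UNIV" using sets_eq_imp_space_eq[OF sets] by simp
  have E: "enlargement A h \<in> events"
    using open_enlargement[of A h] by (simp add: sets)
  have "continuous_on UNIV ?f"
    using lipschitz_cutoff[OF h] by (rule lipschitz_on_continuous_on)
  then have fm: "{x. ?f x > c} \<in> events" for c
    unfolding sets by (intro borel_open open_Collect_less continuous_on_const)
  have "prob A \<le> prob (enlargement A h)"
    by (rule finite_measure_mono[OF subset_enlargement[OF h] E])
  with t have At: "prob A \<le> t" by simp
  have ft: "rearrangement M ?f t \<le> 0"
    unfolding rearrangement_def
  proof (rule cInf_lower)
    have "{x \<in> space M. 0 < ?f x} \<subseteq> enlargement A h"
    proof
      fix x assume "x \<in> {x \<in> space M. 0 < ?f x}"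
      then have "\<not> infdist x A > 3 * h / 4" using cutoff_eq_0[OF h, of x A] by auto
      with h have "infdist x A < h" by linarith
      with False show "x \<in> enlargement A h" by (simp add: enlargement_def)
    qed
    then have "prob {x \<in> space M. 0 < ?f x} \<le> prob (enlargement A h)"
      using E by (rule finite_measure_mono)
    with t show "0 \<in> {c. prob {x \<in> space M. c < ?f x} \<le> t}" by simp
    \<comment> \<open>Here \<open>t < 1\<close> enters: a negative level has the whole space as
      superlevel set and is thus excluded.\<close>
    show "bdd_below {c. prob {x \<in> space M. c < ?f x} \<le> t}"
    proof (rule bdd_belowI[of _ 0], rule ccontr)
      fix c assume c: "c \<in> {c. prob {x \<in> space M. c < ?f x} \<le> t}" "\<not> 0 \<le> c"
      then have "c < ?f x" for x using cutoff_bounds(1)[of A h x] by linarith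
      then have "{x \<in> space M. c < ?f x} = space M" by auto
      with c t show False by (simp add: prob_space)
    qed
  qed
  have fs: "1 \<le> rearrangement M ?f s" if s: "0 < s" "s < prob A" for s
    unfolding rearrangement_def
  proof (rule cInf_greatest)
    have "{x \<in> space M. 1 < ?f x} = {}"
      using cutoff_bounds(2)[of A h] by (auto simp: not_less)
    with s have "1 \<in> {c. prob {x \<in> space M. c < ?f x} \<le> s}"
      by (simp only: mem_Collect_eq measure_empty)
    then show "{c. prob {x \<in> space M. c < ?f x} \<le> s} \<noteq> {}" by blast
    fix c assume c: "c \<in> {c. prob {x \<in> space M. c < ?f x} \<le> s}"
    show "1 \<le> c"
    proof (rule ccontr)
      assume "\<not> 1 \<le> c"
      then have "A \<subseteq> {x \<in> space M. c < ?f x}"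
        using cutoff_eq_1[OF h, of _ A] h by (auto simp: space)
      then have "prob A \<le> prob {x \<in> space M. c < ?f x}"
        using fm by (intro finite_measure_mono) (auto simp: space)
      with c s show False by simp
    qed
  qed
  have "ennreal (prob A) = (\<integral>\<^sup>+s. indicator {0<..<prob A} s \<partial>unit_measure)"
    by (subst nn_integral_indicator) (auto simp: sets_restrict_space_iff emeasure_unit_measure_initial
        intro: less_le_trans[OF _ prob_le_1])
  also have "\<dots> \<le> bfs_norm L1_norm
      (\<lambda>s. (rearrangement M ?f s - rearrangement M ?f t) * indicator {0..<t} s)"
    unfolding bfs_norm_def L1_norm_def
  proof (rule nn_integral_mono)
    fix s
    show "indicator {0<..<prob A} s \<le>
        ennreal \<bar>(rearrangement M ?f s - rearrangement M ?f t) * indicator {0..<t} s\<bar>"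
    proof (cases "s \<in> {0<..<prob A}")
      case True
      then have "1 \<le> \<bar>(rearrangement M ?f s - rearrangement M ?f t) * indicator {0..<t} s\<bar>"
        using fs[of s] ft At by (auto simp: indicator_def)
      then have "ennreal 1 \<le> ennreal \<bar>(rearrangement M ?f s - rearrangement M ?f t) * indicator {0..<t} s\<bar>"
        by (rule ennreal_leI)
      with True show ?thesis by simp
    qed simp
  qed
  finally show ?thesis .
qed simp

section \<open>From enlargements to the perimeter\<close>

lemma measure_enlargement_diff:
  fixes M :: "'a::metric_space measure"
  assumes M: "prob_space M" and sets: "sets M = sets borel" and A: "A \<in> sets borel" and h: "0 < h"
  shows "measure M (enlargement A h - A) = measure M (enlargement A h) - measure M A"
proof -
  interpret prob_space M by (rule M)
  show ?thesis
    using A open_enlargement[of A h] subset_enlargement[OF h]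
    by (intro finite_measure_Diff) (auto simp: sets)
qed

text \<open>The estimate \<open>b\<close> is available only while the enlargement has measure below
  \<open>m\<close>. Either this holds for all small \<open>h\<close> and passes to the lower limit,
  or every enlargement has measure at least \<open>m\<close> and the perimeter is infinite.\<close>

lemma perimeter_lower_bound:
  fixes M :: "'a::metric_space measure"
  assumes M: "prob_space M" and sets: "sets M = sets borel"
    and b: "\<And>h. 0 < h \<Longrightarrow> measure M (enlargement A h) < m \<Longrightarrow>
      b \<le> ennreal K * ennreal ((measure M (enlargement A h) - measure M A) / h)"
    and m: "measure M A < m" and K: "0 < K"
  shows "b \<le> ennreal K * perimeter M A"
proof -
  interpret prob_space M by (rule M)
  let ?q = "\<lambda>h. (prob (enlargement A h) - prob A) / h"
  show ?thesis
  proof (cases "\<exists>h0>0. prob (enlargement A h0) < m")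
    case True
    then obtain h0 where h0: "h0 > 0" "prob (enlargement A h0) < m" by auto
    have "b / ennreal K \<le> perimeter M A"
      unfolding perimeter_def
    proof (rule Liminf_bounded)
      have "eventually (\<lambda>h. 0 < h \<and> h < h0) (at_right 0)"
        using h0 by (auto simp: eventually_at_right_field)
      then show "eventually (\<lambda>h. b / ennreal K \<le> ennreal (?q h)) (at_right 0)"
      proof eventually_elim
        case (elim h)
        have "prob (enlargement A h) \<le> prob (enlargement A h0)"
          using elim enlargement_mono[of h h0 A] open_enlargement[of A h0]
          by (intro finite_measure_mono) (auto simp: sets)
        then show ?case
          using elim h0 K by (intro divide_le_posI_ennreal b) auto
      qed
    qed
    then have "ennreal K * (b / ennreal K) \<le> ennreal K * perimeter M A"
      by (rule mult_left_mono) simp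
    then show ?thesis
      using K by (simp add: ennreal_times_divide ennreal_mult_divide_eq mult.commute)
  next
    case False
    have "\<top> \<le> Liminf (at_right 0) (\<lambda>h. ennreal (?q h))"
      unfolding le_Liminf_iff
    proof (intro allI impI)
      fix y :: ennreal assume "y < \<top>"
      then obtain c where c: "y = ennreal c" "0 \<le> c"
        by (cases y) auto
      \<comment> \<open>The numerator of the quotient stays at least \<open>m - prob A\<close>, so
        for \<open>h\<close> below this threshold the quotient exceeds \<open>c + 1\<close>. The
        added 1 keeps the denominator positive when \<open>c\<close> is 0.\<close>
      have "eventually (\<lambda>h. 0 < h \<and> h < (m - prob A) / (c + 1)) (at_right 0)"
        using m c by (auto simp: eventually_at_right_field intro!: exI[of _ "(m - prob A) / (c + 1)"])
      then show "eventually (\<lambda>h. y < ennreal (?q h)) (at_right 0)"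
      proof eventually_elim
        case (elim h)
        have "m \<le> prob (enlargement A h)"
          using False elim by (meson not_less)
        moreover have "(c + 1) * h < m - prob A"
          using elim c by (simp add: field_simps)
        ultimately have "c + 1 < ?q h"
          using elim by (simp add: less_divide_eq)
        then show ?case using c by (auto intro: ennreal_lessI)
      qed
    qed
    then show ?thesis using K by (simp add: perimeter_def top_unique ennreal_mult_top)
  qed
qed

text \<open>The measure of the enlargement need not tend to that of \<open>A\<close> (the closure
  may be larger), so the left endpoint cannot simply be sent to its limit. Instead the interval is
  exhausted by \<open>?I n\<close>, each treated with its own threshold, and continuity from below
  finishes.\<close>

lemma weighted_bound:
  fixes M :: "'a::metric_space measure" and \<nu> :: "real measure"
  assumes M: "prob_space M" and sets: "sets M = sets borel"
    and \<nu>: "sets \<nu> = sets lebesgue" and K: "0 < K"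
    and b: "\<And>h. 0 < h \<Longrightarrow>
      ennreal (measure M A) * emeasure \<nu> {measure M (enlargement A h)<..<r}
        \<le> ennreal K * ennreal ((measure M (enlargement A h) - measure M A) / h)"
  shows "ennreal (measure M A) * emeasure \<nu> {measure M A<..<r} \<le> ennreal K * perimeter M A"
proof -
  let ?m = "measure M A" and ?I = "\<lambda>n. {measure M A + 1 / real (Suc n)<..<r}"
  have "{?m<..<r} = (\<Union>n. ?I n)"
  proof -
    have "\<exists>n. ?m + 1 / real (Suc n) < x" if "?m < x" for x
      using reals_Archimedean[of "x - ?m"] that by (auto simp: field_simps)
    moreover have "?m < x" if "?m + 1 / real (Suc n) < x" for n x
    proof -
      have "0 < 1 / real (Suc n)" by simp
      with that show ?thesis by linarith
    qed
    ultimately show ?thesis by (auto simp del: of_nat_Suc)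
  qed
  moreover have "incseq ?I"
  proof (rule incseq_SucI)
    fix n
    have "1 / real (Suc (Suc n)) \<le> 1 / real (Suc n)" by (rule frac_le) auto
    then show "?I n \<subseteq> ?I (Suc n)" by (auto simp del: of_nat_Suc)
  qed
  ultimately have "emeasure \<nu> {?m<..<r} = (SUP n. emeasure \<nu> (?I n))"
    using \<nu> by (subst SUP_emeasure_incseq) auto
  then have "ennreal ?m * emeasure \<nu> {?m<..<r} = (SUP n. ennreal ?m * emeasure \<nu> (?I n))"
    by (simp add: SUP_mult_left_ennreal)
  also have "\<dots> \<le> ennreal K * perimeter M A"
  proof (rule SUP_least, rule perimeter_lower_bound[OF M sets])
    fix n h assume h: "0 < h" "measure M (enlargement A h) < ?m + 1 / real (Suc n)"
    have "ennreal ?m * emeasure \<nu> (?I n) \<le> ennreal ?m * emeasure \<nu> {measure M (enlargement A h)<..<r}"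
      using h \<nu> by (intro mult_left_mono emeasure_mono) auto
    also note b[OF h(1)]
    finally show "ennreal ?m * emeasure \<nu> (?I n)
        \<le> ennreal K * ennreal ((measure M (enlargement A h) - measure M A) / h)" .
  qed (use K in auto)
  finally show ?thesis .
qed

section \<open>The bounds for the perimeter and for the profile\<close>

theorem corollary1:
  fixes \<mu> :: "'a::metric_space measure" and r :: real and G :: "real \<Rightarrow> real"
  assumes "connected (UNIV :: 'a set)"
    and "prob_space \<mu>" and "sets \<mu> = sets borel"
    and "isoperimetric_profile \<mu> 0 = 0"
    and "\<forall>s\<in>{0..1}. isoperimetric_profile \<mu> s < \<infinity>"
    and "continuous_on {0..1} (\<lambda>s. enn2real (isoperimetric_profile \<mu> s))"
    and "concave_on {0..1} (\<lambda>s. enn2real (isoperimetric_profile \<mu> s))"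
    and "\<forall>s\<in>{0..1}. isoperimetric_profile \<mu> (1 - s) = isoperimetric_profile \<mu> s"
    and "0 < r" and "r \<le> 1"
    and "G \<in> borel_measurable (lebesgue_on {0<..<r})"
    and "\<forall>t\<in>{0<..<r}. G t > 0"
    and "\<forall>\<rho>. ri_space \<rho> \<and> away_from_Linfty \<rho> \<longrightarrow>
           (\<exists>C\<ge>0. \<forall>f :: 'a \<Rightarrow> real. (\<exists>L. L-lipschitz_on UNIV f) \<longrightarrow>
              (\<integral>\<^sup>+t\<in>{0<..<r}.
                 bfs_norm \<rho> (\<lambda>s. (rearrangement \<mu> f s - rearrangement \<mu> f t) * indicator {0..<t} s)
                 * ennreal (G t) \<partial>lebesgue)
              \<le> ennreal C * bfs_norm \<rho> (rearrangement \<mu> (grad_modulus f)))"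
  shows "\<exists>C>0.
           (\<forall>A\<in>sets borel. measure \<mu> A \<le> r \<longrightarrow>
              ennreal (measure \<mu> A) * (\<integral>\<^sup>+t\<in>{measure \<mu> A<..<r}. ennreal (G t) \<partial>lebesgue)
              \<le> ennreal C * perimeter \<mu> A) \<and>
           (\<forall>t\<in>{0<..<r}.
              ennreal t / isoperimetric_profile \<mu> t * (\<integral>\<^sup>+s\<in>{t<..<r}. ennreal (G s) \<partial>lebesgue)
              \<le> ennreal C)"
proof -
  interpret prob_space \<mu> by fact
  note sets = \<open>sets \<mu> = sets borel\<close>
  obtain C where C: "0 \<le> C" and hyp: "\<And>(f :: 'a \<Rightarrow> real) L. L-lipschitz_on UNIV f \<Longrightarrow>
      (\<integral>\<^sup>+t\<in>{0<..<r}.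
         bfs_norm L1_norm (\<lambda>s. (rearrangement \<mu> f s - rearrangement \<mu> f t) * indicator {0..<t} s)
         * ennreal (G t) \<partial>lebesgue)
      \<le> ennreal C * bfs_norm L1_norm (rearrangement \<mu> (grad_modulus f))"
    using assms(13)[THEN spec, of L1_norm] ri_space_L1 away_from_Linfty_L1 by blast
  \<comment> \<open>The factor 2 is that of the gradient bound \<open>2 / h\<close>; the added 1
    keeps \<open>K\<close> positive even for \<open>C = 0\<close>, so that division by
    \<open>K\<close> is possible.\<close>
  define K where "K = 2 * C + 1"
  have K: "0 < K" using C by (simp add: K_def)
  have "(\<lambda>t. indicator {0<..<r} t *\<^sub>R G t) \<in> borel_measurable lebesgue"
    using assms(11) by (subst (asm) borel_measurable_restrict_space_iff) auto
  then have Gm: "(\<lambda>t. ennreal (indicator {0<..<r} t *\<^sub>R G t)) \<in> borel_measurable lebesgue"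
    by measurable
  \<comment> \<open>Encoding G(t) dt, with \<open>G\<close> extended by zero, as a measure turns the
    exhaustion of the interval into continuity of a measure.\<close>
  define \<nu> where "\<nu> = density lebesgue (\<lambda>t. ennreal (indicator {0<..<r} t *\<^sub>R G t))"
  have \<nu>_sets: "sets \<nu> = sets lebesgue" by (simp add: \<nu>_def)
  have \<nu>: "emeasure \<nu> {a<..<r} = (\<integral>\<^sup>+t\<in>{a<..<r}. ennreal (G t) \<partial>lebesgue)" if "0 \<le> a" for a
    unfolding \<nu>_def using Gm that
    by (subst emeasure_density) (auto intro!: nn_integral_cong simp: indicator_def)
  have bound: "ennreal (prob A) * emeasure \<nu> {prob A<..<r} \<le> ennreal K * perimeter \<mu> A"
    if A: "A \<in> sets borel" for A
  proof (cases "A = {}")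
    case False
    show ?thesis
    proof (rule weighted_bound[OF \<open>prob_space \<mu>\<close> sets \<nu>_sets K])
      fix h :: real assume h: "0 < h"
      let ?f = "cutoff A h"
      let ?N = "\<lambda>t. bfs_norm L1_norm
        (\<lambda>s. (rearrangement \<mu> ?f s - rearrangement \<mu> ?f t) * indicator {0..<t} s)"
      have S: "enlargement A h - A \<in> events"
        using A open_enlargement[of A h] by (auto simp: sets)
      have grad: "0 \<le> grad_modulus ?f x" "grad_modulus ?f x \<le> 2 / h" for x
        using grad_modulus_bounds[of "2 / h" ?f x] cutoff_diff_le[OF h, of A x] h by auto
      have "ennreal (prob A) * emeasure \<nu> {prob (enlargement A h)<..<r} =
          (\<integral>\<^sup>+t. ennreal (prob A) *
            (ennreal (indicator {0<..<r} t *\<^sub>R G t) * indicator {prob (enlargement A h)<..<r} t) \<partial>lebesgue)"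
        unfolding \<nu>_def using Gm
        by (subst nn_integral_cmult)
          (auto intro!: borel_measurable_times_ennreal borel_measurable_indicator simp: emeasure_density)
      also have "\<dots> \<le> (\<integral>\<^sup>+t\<in>{0<..<r}. ?N t * ennreal (G t) \<partial>lebesgue)"
      proof (rule nn_integral_mono)
        fix t
        have "ennreal (prob A) \<le> ?N t" if "prob (enlargement A h) < t" "t < r"
          using that \<open>r \<le> 1\<close>
          by (intro L1_norm_rearrangement_cutoff_ge[OF \<open>prob_space \<mu>\<close> sets h]) auto
        then show "ennreal (prob A) * (ennreal (indicator {0<..<r} t *\<^sub>R G t) *
              indicator {prob (enlargement A h)<..<r} t) \<le> ?N t * ennreal (G t) * indicator {0<..<r} t"
          by (auto simp: indicator_def intro!: mult_right_mono)
      qed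
      also have "\<dots> \<le> ennreal C * bfs_norm L1_norm (rearrangement \<mu> (grad_modulus ?f))"
        by (rule hyp[OF lipschitz_cutoff[OF h]])
      also have "\<dots> \<le> ennreal C * ennreal (2 / h * prob (enlargement A h - A))"
        using grad h grad_cutoff_eq_0[OF h False]
        by (intro mult_left_mono L1_norm_rearrangement_le[OF S]) auto
      also have "\<dots> = ennreal (2 * C * (prob (enlargement A h - A) / h))"
        using C h by (simp add: ennreal_mult[symmetric])
      also have "\<dots> \<le> ennreal (K * (prob (enlargement A h - A) / h))"
        using h by (intro ennreal_leI mult_right_mono) (auto simp: K_def)
      also have "\<dots> = ennreal K * ennreal ((prob (enlargement A h) - prob A) / h)"
        unfolding measure_enlargement_diff[OF \<open>prob_space \<mu>\<close> sets A h, symmetric]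
        using K h by (intro ennreal_mult) auto
      finally show "ennreal (prob A) * emeasure \<nu> {prob (enlargement A h)<..<r}
          \<le> ennreal K * ennreal ((prob (enlargement A h) - prob A) / h)" .
    qed
  qed simp
  show ?thesis
  proof (intro exI[of _ K] conjI ballI impI)
    fix A :: "'a set" assume "A \<in> sets borel"
    from bound[OF this]
    show "ennreal (prob A) * (\<integral>\<^sup>+t\<in>{prob A<..<r}. ennreal (G t) \<partial>lebesgue)
        \<le> ennreal K * perimeter \<mu> A"
      by (simp add: \<nu>)
  next
    fix t assume t: "t \<in> {0<..<r}"
    let ?I = "isoperimetric_profile \<mu> t" and ?J = "emeasure \<nu> {t<..<r}"
    have I_fin: "?I < \<infinity>" using assms(5) t \<open>r \<le> 1\<close> by auto
    \<comment> \<open>The perimeter bound applies to every competitor \<open>A\<close> of measure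
      \<open>t\<close>; the infimum over them is the profile.\<close>
    have "ennreal t * ?J / ennreal K \<le> ?I"
      unfolding isoperimetric_profile_def
      by (rule INF_greatest) (use bound K in \<open>force intro!: divide_le_posI_ennreal\<close>)
    then have "ennreal K * (ennreal t * ?J / ennreal K) \<le> ennreal K * ?I"
      by (rule mult_left_mono) simp
    then have le: "ennreal t * ?J \<le> ennreal K * ?I"
      using K by (simp add: ennreal_times_divide ennreal_mult_divide_eq mult.commute[of "ennreal K"])
    \<comment> \<open>Positivity of \<open>G\<close> forces the profile to be positive at
      \<open>t\<close>. Otherwise the quotient \<open>ennreal t / ?I\<close> would be infinite in
      \<open>ennreal\<close>.\<close>
    have "?J \<noteq> 0"
    proof
      assume "?J = 0"
      then have "AE s in lebesgue. ennreal (indicator {0<..<r} s *\<^sub>R G s) * indicator {t<..<r} s = 0"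
        using Gm unfolding \<nu>_def
        by (subst nn_integral_0_iff_AE[symmetric])
          (auto intro!: borel_measurable_times_ennreal borel_measurable_indicator simp: emeasure_density)
      then have "AE s in lebesgue. s \<notin> {t<..<r}"
      proof eventually_elim
        case (elim s)
        then show ?case
          using t assms(12)[THEN bspec, of s] by (auto simp: indicator_def ennreal_eq_0_iff)
      qed
      then have "emeasure lebesgue {t<..<r} = 0"
        by (subst (asm) AE_iff_measurable[of "{t<..<r}"]) auto
      with t show False by simp
    qed
    then have I_pos: "?I \<noteq> 0" using le t by auto
    have "ennreal t / ?I * ?J = ennreal t * ?J / ?I"
      by (simp add: ennreal_divide_times ennreal_times_divide)
    also have "\<dots> \<le> ennreal K"
      using le I_pos by (intro divide_le_posI_ennreal) (auto simp: mult.commute zero_less_iff_neq_zero)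
    finally show "ennreal t / ?I * (\<integral>\<^sup>+s\<in>{t<..<r}. ennreal (G s) \<partial>lebesgue) \<le> ennreal K"
      using t by (simp add: \<nu>)
  qed (rule K)
qed

end
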